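(* Let $X=\mathbb{R}/\mathbb{Z}$ be the unit circle and $T(x)=x+\alpha\pmod 1$, where $\alpha\in(0,1)$ is irrational with continued fraction expansion $\alpha=[a_1,a_2,\dots]$ such that $a_i=O(1)$ (i.e. the partial quotients are bounded). Let $\mathcal{Z}=\{[0,1/2),[1/2,1)\}$. Then $\underline{R}(x,T,\mathcal{Z})>0$ for all $x\in X$.
   Context: $Z_n(x)$ is the element of $\bigvee_{k=0}^{n-1}T^{-k}\mathcal{Z}$ containing $x$. For $A\subset X$, $\tau(A)=\min\{k>0:T^kA\cap A\neq\emptyset\}$. The lower $\mathcal{Z}$-recurrence rate is $\underline{R}(x,T,\mathcal{Z})=\liminf_{n\to\infty}\tau(Z_n(x))/n$. *)

theory Defs
  imports Complex_Main "HOL-Library.Landau_Symbols" "HOL-Library.Extended_Real"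
begin

quotient_type circle = real / "\<lambda>x y :: real. x - y \<in> \<int>"
  morphisms rep_circle to_circle
proof (rule equivpI)
  show "reflp (\<lambda>x y :: real. x - y \<in> \<int>)"
    by (rule reflpI) simp
  show "symp (\<lambda>x y :: real. x - y \<in> \<int>)"
    by (rule sympI) (metis Ints_minus minus_diff_eq)
  show "transp (\<lambda>x y :: real. x - y \<in> \<int>)"
  proof (rule transpI)
    fix x y z :: real
    assume "x - y \<in> \<int>" "y - z \<in> \<int>"
    then have "(x - y) + (y - z) \<in> \<int>" by (rule Ints_add)
    then show "x - z \<in> \<int>" by simp
  qed
qed

lift_definition rotation :: "real \<Rightarrow> circle \<Rightarrow> circle" is "\<lambda>\<alpha> x. x + \<alpha>"
  by simp

definition half_circles :: "circle set set" where
  "half_circles = {to_circle ` {0..<1/2}, to_circle ` {1/2..<1}}"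

definition join_partitions :: "'i set \<Rightarrow> ('i \<Rightarrow> 'a set set) \<Rightarrow> 'a set set" where
  "join_partitions I P =
     {B. B \<noteq> {} \<and> (\<exists>A. (\<forall>k\<in>I. A k \<in> P k) \<and> B = (\<Inter>k\<in>I. A k))}"

definition pullback_partition :: "('a \<Rightarrow> 'a) \<Rightarrow> nat \<Rightarrow> 'a set set \<Rightarrow> 'a set set" where
  "pullback_partition T k Z = (\<lambda>A. (T ^^ k) -` A) ` Z"

definition cylinder :: "('a \<Rightarrow> 'a) \<Rightarrow> 'a set set \<Rightarrow> nat \<Rightarrow> 'a \<Rightarrow> 'a set" where
  "cylinder T Z n x =
     (THE A. A \<in> join_partitions {0..<n} (\<lambda>k. pullback_partition T k Z) \<and> x \<in> A)"

text \<open>With values in \<^typ>\<open>enat\<close>: the minimum of the empty set of return times is \<open>\<infinity>\<close>.\<close>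

definition return_time :: "('a \<Rightarrow> 'a) \<Rightarrow> 'a set \<Rightarrow> enat" where
  "return_time T A = Inf (enat ` {k. k > 0 \<and> (T ^^ k) ` A \<inter> A \<noteq> {}})"

definition lower_recurrence_rate :: "'a \<Rightarrow> ('a \<Rightarrow> 'a) \<Rightarrow> 'a set set \<Rightarrow> ereal" where
  "lower_recurrence_rate x T Z =
     liminf (\<lambda>n. ereal_of_enat (return_time T (cylinder T Z n x)) / ereal (real n))"

text \<open>The finite continued fraction \<open>[a\<^sub>1, \<dots>, a\<^sub>n] = 1 / (a\<^sub>1 + 1 / (\<dots> + 1 / a\<^sub>n))\<close>.\<close>

fun finite_cfrac :: "nat list \<Rightarrow> real" where
  "finite_cfrac [] = 0"
| "finite_cfrac (a # as) = 1 / (real a + finite_cfrac as)"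

text \<open>\<open>\<alpha> = [a\<^sub>1, a\<^sub>2, \<dots>]\<close> as an infinite regular continued fraction with integer part 0.
  Partial quotients are indexed from 1; the value \<open>a 0\<close> plays no role.\<close>

definition has_cfrac_expansion :: "real \<Rightarrow> (nat \<Rightarrow> nat) \<Rightarrow> bool" where
  "has_cfrac_expansion \<alpha> a \<longleftrightarrow>
     (\<forall>i\<ge>1. a i \<ge> 1) \<and> (\<lambda>n. finite_cfrac (map a [1..<Suc n])) \<longlonglongrightarrow> \<alpha>"

end

theory Submission
  imports Defs "HOL-Analysis.Kronecker_Approximation_Theorem" "HOL-Number_Theory.Cong"
begin

text \<open>
  Bounded partial quotients make \<open>\<alpha>\<close> badly approximable: \<open>\<parallel>k\<alpha>\<parallel> \<ge> c/k\<close> for all \<open>k \<ge> 1\<close>.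
  Dirichlet's theorem gives \<open>p/q\<close> with \<open>q \<le> n\<close> and \<open>|\<alpha> - p/q| < 1/(qn)\<close>, and bad
  approximability forces \<open>q > cn\<close>; so the first \<open>n\<close> points of any orbit lie close to a coset of
  \<open>(1/q)\<int>\<close> with \<open>1/q < 1/(cn)\<close> and meet every arc of length \<open>C/n\<close>. If \<open>x\<close> and \<open>y\<close> are at distance
  \<open>d \<ge> C/n\<close>, the orbit meets the arc of length \<open>d\<close> ending at \<open>1/2\<close>, and at that time \<open>x\<close> and \<open>y\<close> are
  separated by the partition. Hence cylinders have diameter at most \<open>C/n\<close>, and a return at
  time \<open>k\<close> implies \<open>c/k \<le> \<parallel>k\<alpha>\<parallel> \<le> C/n\<close>, that is \<open>k \<ge> (c/C) n\<close>.
\<close>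

section \<open>Continued fractions\<close>

text \<open>The indices are shifted by one: \<open>cfrac_num a (Suc n) / cfrac_den a (Suc n)\<close> is the
  convergent \<open>[a\<^sub>1, \<dots>, a\<^sub>n]\<close>.\<close>

fun cfrac_num :: "(nat \<Rightarrow> nat) \<Rightarrow> nat \<Rightarrow> int" where
  "cfrac_num a 0 = 1"
| "cfrac_num a (Suc 0) = 0"
| "cfrac_num a (Suc (Suc n)) = int (a (Suc n)) * cfrac_num a (Suc n) + cfrac_num a n"

fun cfrac_den :: "(nat \<Rightarrow> nat) \<Rightarrow> nat \<Rightarrow> int" where
  "cfrac_den a 0 = 0"
| "cfrac_den a (Suc 0) = 1"
| "cfrac_den a (Suc (Suc n)) = int (a (Suc n)) * cfrac_den a (Suc n) + cfrac_den a n"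

text \<open>Each step of the recursion multiplies the 2x2 matrix of two consecutive columns by a
  matrix of determinant -1.\<close>

lemma cfrac_det:
  "cfrac_num a n * cfrac_den a (Suc n) - cfrac_num a (Suc n) * cfrac_den a n = (-1) ^ n"
  by (induction n) (auto simp: algebra_simps)

lemma cfrac_den_pos:
  assumes "\<forall>i\<ge>1. a i \<ge> 1"
  shows "cfrac_den a n \<ge> 0 \<and> cfrac_den a (Suc n) \<ge> 1"
proof (induction n)
  case (Suc n)
  have "1 * 1 \<le> int (a (Suc n)) * cfrac_den a (Suc n)"
    using assms Suc by (intro mult_mono) auto
  then show ?case using Suc by simp
qed simp

lemma cfrac_den_bounds:
  assumes "\<forall>i\<ge>1. a i \<ge> 1"
  shows "cfrac_den a n \<ge> 0 \<and> cfrac_den a (Suc n) \<ge> 1 \<and> cfrac_den a (Suc n) \<ge> int n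
         \<and> cfrac_den a n \<le> cfrac_den a (Suc n)"
proof (induction n)
  case (Suc n)
  have "1 * cfrac_den a (Suc n) \<le> int (a (Suc n)) * cfrac_den a (Suc n)"
    using assms Suc by (intro mult_right_mono) auto
  then have *: "cfrac_den a (Suc (Suc n)) \<ge> cfrac_den a (Suc n) + cfrac_den a n"
    by simp
  \<comment> \<open>The denominators gain at least 1 per step only once the previous one is
    positive; \<open>cfrac_den a 0\<close> is 0, so the first step is done by hand.\<close>
  show ?case
  proof (cases n)
    case 0
    then show ?thesis using assms by simp
  next
    case (Suc m)
    then have "cfrac_den a n \<ge> 1"
      using cfrac_den_pos[OF assms, of m] by simp
    then show ?thesis using * Suc.IH by linarith
  qed
qed simp

lemma finite_cfrac_bounds:
  assumes "\<forall>b\<in>set bs. b \<ge> 1"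
  shows "0 \<le> finite_cfrac bs \<and> finite_cfrac bs \<le> 1"
  using assms
proof (induction bs)
  case (Cons b bs)
  then have "real b \<ge> 1" "0 \<le> finite_cfrac bs" by auto
  then show ?case by (auto simp: divide_simps)
qed simp

text \<open>The value of the tail enters through a Moebius map whose coefficients come from two
  consecutive convergents. In the induction the last partial quotient moves into the tail, hence the
  arbitrary \<open>bs\<close>.\<close>

lemma finite_cfrac_append:
  assumes "\<forall>i\<ge>1. a i \<ge> 1" and "\<forall>b\<in>set bs. b \<ge> 1"
  shows "finite_cfrac (map a [1..<Suc n] @ bs) =
    (cfrac_num a (Suc n) + cfrac_num a n * finite_cfrac bs) /
    (cfrac_den a (Suc n) + cfrac_den a n * finite_cfrac bs)"
  using assms(2)
proof (induction n arbitrary: bs)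
  case (Suc n)
  define t where "t = finite_cfrac bs"
  have "a (Suc n) \<ge> 1" "t \<ge> 0"
    using assms(1) Suc.prems finite_cfrac_bounds t_def by auto
  then have pos: "real (a (Suc n)) + t > 0"
    by linarith
  have "finite_cfrac (map a [1..<Suc (Suc n)] @ bs)
      = finite_cfrac (map a [1..<Suc n] @ (a (Suc n) # bs))"
    by simp
  also have "\<dots> = (cfrac_num a (Suc n) + cfrac_num a n * (1 / (a (Suc n) + t))) /
      (cfrac_den a (Suc n) + cfrac_den a n * (1 / (a (Suc n) + t)))"
    using Suc.IH[of "a (Suc n) # bs"] Suc.prems \<open>a (Suc n) \<ge> 1\<close> by (simp add: t_def)
  also have "\<dots> = ((cfrac_num a (Suc n) + cfrac_num a n * (1 / (a (Suc n) + t))) * (a (Suc n) + t)) /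
      ((cfrac_den a (Suc n) + cfrac_den a n * (1 / (a (Suc n) + t))) * (a (Suc n) + t))"
    using pos by (subst mult_divide_mult_cancel_right) auto
  also have "\<dots> = (cfrac_num a (Suc (Suc n)) + cfrac_num a (Suc n) * t) /
      (cfrac_den a (Suc (Suc n)) + cfrac_den a (Suc n) * t)"
  proof -
    have "(u + v * (1 / (a (Suc n) + t))) * (a (Suc n) + t) = a (Suc n) * u + v + u * t" for u v :: real
      using pos by (simp add: field_simps)
    then show ?thesis by simp
  qed
  finally show ?case by (simp only: t_def)
qed simp

text \<open>Every longer finite fraction is the Moebius image of a tail value in [0, 1]. The
  determinant bounds its distance from the convergent uniformly, and the bound survives the
  limit.\<close>

lemma cfrac_approx:
  fixes \<alpha> :: real
  assumes "has_cfrac_expansion \<alpha> a"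
  shows "\<bar>cfrac_den a (Suc n) * \<alpha> - cfrac_num a (Suc n)\<bar> \<le> 1 / cfrac_den a (Suc n)"
proof -
  have a1: "\<forall>i\<ge>1. a i \<ge> 1" and lim: "(\<lambda>n. finite_cfrac (map a [1..<Suc n])) \<longlonglongrightarrow> \<alpha>"
    using assms by (auto simp: has_cfrac_expansion_def)
  define P P' Q Q' where "P = real_of_int (cfrac_num a (Suc n))" "P' = real_of_int (cfrac_num a n)"
    "Q = real_of_int (cfrac_den a (Suc n))" "Q' = real_of_int (cfrac_den a n)"
  note defs = this
  have Q: "Q \<ge> 1" "Q' \<ge> 0"
    using cfrac_den_bounds[OF a1, of n] by (auto simp: defs)
  have "P' * Q - P * Q' = (-1) ^ n"
    using arg_cong[OF cfrac_det[of a n], of real_of_int] by (simp add: defs)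
  then have det: "\<bar>P' * Q - P * Q'\<bar> = 1" by simp
  have bound: "\<bar>Q * finite_cfrac (map a [1..<Suc m]) - P\<bar> \<le> 1 / Q" if "m \<ge> n" for m
  proof -
    define bs where "bs = map a [Suc n..<Suc m]"
    define t where "t = finite_cfrac bs"
    have bs: "\<forall>b\<in>set bs. b \<ge> 1"
      using a1 by (auto simp: bs_def)
    have t: "0 \<le> t" "t \<le> 1"
      using finite_cfrac_bounds[OF bs] by (auto simp: t_def)
    have "[1..<Suc m] = [1..<Suc n] @ [Suc n..<Suc m]"
      using upt_add_eq_append[of 1 "Suc n" "m - n"] that by simp
    then have "finite_cfrac (map a [1..<Suc m]) = (P + P' * t) / (Q + Q' * t)"
      using finite_cfrac_append[OF a1 bs, of n] by (simp add: bs_def t_def defs)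
    moreover have D: "Q + Q' * t \<ge> Q" using Q t by simp
    ultimately have "Q * finite_cfrac (map a [1..<Suc m]) - P = t * (P' * Q - P * Q') / (Q + Q' * t)"
      using Q by (simp add: field_simps)
    also have "\<bar>\<dots>\<bar> = t / (Q + Q' * t)"
      using det t D Q by (simp add: abs_mult)
    also have "\<dots> \<le> 1 / Q"
      using t D Q by (intro frac_le) auto
    finally show ?thesis .
  qed
  have "(\<lambda>m. \<bar>Q * finite_cfrac (map a [1..<Suc m]) - P\<bar>) \<longlonglongrightarrow> \<bar>Q * \<alpha> - P\<bar>"
    by (intro tendsto_intros lim)
  then have "\<bar>Q * \<alpha> - P\<bar> \<le> 1 / Q"
    by (rule LIMSEQ_le_const2) (use bound in blast)
  then show ?thesis by (simp add: defs)
qed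

text \<open>Letting \<open>m\<close> run over all integers expresses the distance from
  \<open>k * \<alpha>\<close> to the nearest integer.\<close>

definition badly_approximable :: "real \<Rightarrow> real \<Rightarrow> bool" where
  "badly_approximable c \<alpha> \<longleftrightarrow>
     c > 0 \<and> (\<forall>(k :: int) (m :: int). k > 0 \<longrightarrow> c / k \<le> \<bar>k * \<alpha> - m\<bar>)"

lemma badly_approximableD:
  assumes "badly_approximable c \<alpha>"
  shows "c > 0" and "k > 0 \<Longrightarrow> c / real_of_int k \<le> \<bar>k * \<alpha> - real_of_int m\<bar>"
  using assms by (auto simp: badly_approximable_def)

text \<open>If \<open>p/q\<close> is a convergent different from \<open>m/k\<close>, then
  \<open>1 \<le> |mq - kp| \<le> q |k\<alpha> - m| + k |q\<alpha> - p|\<close>; take the first convergent with \<open>q \<ge> 2k\<close>, or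
  the next one.\<close>

lemma bounded_cfrac_imp_badly_approximable:
  assumes cf: "has_cfrac_expansion \<alpha> a" and M: "\<And>i. a i \<le> M"
  obtains c where "badly_approximable c \<alpha>"
proof -
  have a1: "\<forall>i\<ge>1. a i \<ge> 1"
    using cf by (auto simp: has_cfrac_expansion_def)
  let ?P = "cfrac_num a" and ?Q = "cfrac_den a"
  have growth: "?Q (Suc (Suc n)) \<le> (int M + 1) * ?Q (Suc n)" for n
  proof -
    have "int (a (Suc n)) * ?Q (Suc n) \<le> int M * ?Q (Suc n)"
      using M cfrac_den_bounds[OF a1, of n] by (intro mult_right_mono) auto
    then show ?thesis
      using cfrac_den_bounds[OF a1, of n] unfolding cfrac_den.simps distrib_right by linarith
  qed
  \<comment> \<open>The constant comes from
    \<open>1 / 2 \<le> q * \<bar>k * \<alpha> - m\<bar>\<close> with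
    \<open>q \<le> 2 * (M + 1)\<^sup>2 * k\<close>.\<close>
  have "1 / (4 * (M + 1)\<^sup>2) / k \<le> \<bar>k * \<alpha> - m\<bar>" if k: "k > 0" for k m :: int
  proof -
    have "?Q (Suc (nat (2 * k))) \<ge> 2 * k"
      using cfrac_den_bounds[OF a1, of "nat (2 * k)"] k by simp
    then have ex: "\<exists>j. ?Q (Suc j) \<ge> 2 * k" ..
    define j where "j = (LEAST j. ?Q (Suc j) \<ge> 2 * k)"
    have j: "?Q (Suc j) \<ge> 2 * k"
      unfolding j_def by (rule LeastI_ex[OF ex])
    \<comment> \<open>The first denominator is 1 < 2k, so \<open>j\<close> has a predecessor. By
      minimality its denominator is below 2k, and each of the two growth steps from there costs a
      factor M + 1.\<close>
    have "j \<noteq> 0" using j k by (cases j) auto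
    then obtain i where i: "j = Suc i" by (cases j) auto
    have "\<not> ?Q (Suc i) \<ge> 2 * k"
      using not_less_Least[of i "\<lambda>j. ?Q (Suc j) \<ge> 2 * k"] i by (simp add: j_def)
    then have "(int M + 1) * ?Q (Suc i) \<le> (int M + 1) * (2 * k)"
      by (intro mult_left_mono) auto
    then have up1: "?Q (Suc j) \<le> (int M + 1) * (2 * k)"
      using growth[of i] unfolding i by (rule order_trans[rotated])
    then have "(int M + 1) * ?Q (Suc j) \<le> (int M + 1) * ((int M + 1) * (2 * k))"
      by (intro mult_left_mono) auto
    then have up2: "?Q (Suc (Suc j)) \<le> (int M + 1) * ((int M + 1) * (2 * k))"
      using growth[of j] by linarith
    \<comment> \<open>If both convergents were equal to m/k, their determinant would vanish, but it
      is 1 or -1.\<close>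
    have ne: "m * ?Q (Suc j) - k * ?P (Suc j) \<noteq> 0 \<or>
        m * ?Q (Suc (Suc j)) - k * ?P (Suc (Suc j)) \<noteq> 0"
    proof (rule ccontr)
      assume "\<not> ?thesis"
      then have "m * ?Q (Suc j) = k * ?P (Suc j)"
          "m * ?Q (Suc (Suc j)) = k * ?P (Suc (Suc j))" by auto
      then have "k * (?P (Suc j) * ?Q (Suc (Suc j)) - ?P (Suc (Suc j)) * ?Q (Suc j)) = 0"
        by (simp only: right_diff_distrib mult.assoc[symmetric]) (metis diff_self mult.commute mult.assoc)
      then show False
        using k cfrac_det[of a "Suc j"] by simp
    qed
    have mono: "?Q (Suc j) \<le> ?Q (Suc (Suc j))"
      using cfrac_den_bounds[OF a1, of "Suc j"] by blast
    obtain l where l: "m * ?Q (Suc l) - k * ?P (Suc l) \<noteq> 0" "?Q (Suc l) \<ge> 2 * k"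
        "?Q (Suc l) \<le> (int M + 1) * ((int M + 1) * (2 * k))"
      using ne j up2 mono by (meson order_trans)
    define q p where "q = real_of_int (?Q (Suc l))" and "p = real_of_int (?P (Suc l))"
    have q: "q \<ge> 2 * k"
      using l(2) unfolding q_def by linarith
    have "real_of_int (?Q (Suc l)) \<le> real_of_int ((int M + 1) * ((int M + 1) * (2 * k)))"
      using l(3) by (simp only: of_int_le_iff)
    then have qle: "q \<le> 2 * (M + 1)\<^sup>2 * k"
      by (simp add: q_def power2_eq_square algebra_simps)
    have qpos: "q > 0" using q k by linarith
    have approx: "\<bar>q * \<alpha> - p\<bar> \<le> 1 / q"
      using cfrac_approx[OF cf] by (simp add: q_def p_def)
    have "\<bar>m * ?Q (Suc l) - k * ?P (Suc l)\<bar> \<ge> 1" using l(1) by linarith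
    then have "1 \<le> real_of_int \<bar>m * ?Q (Suc l) - k * ?P (Suc l)\<bar>" by linarith
    also have "\<dots> = \<bar>k * (q * \<alpha> - p) - q * (k * \<alpha> - m)\<bar>"
      by (simp add: q_def p_def algebra_simps)
    also have "\<dots> \<le> k * \<bar>q * \<alpha> - p\<bar> + q * \<bar>k * \<alpha> - m\<bar>"
      using abs_triangle_ineq4[of "k * (q * \<alpha> - p)" "q * (k * \<alpha> - m)"] k qpos
      by (simp add: abs_mult)
    also have "k * \<bar>q * \<alpha> - p\<bar> \<le> k * (1 / q)"
      using approx k by (intro mult_left_mono) auto
    \<comment> \<open>This is the reason for the threshold 2k: half of the 1 on the left remains for
      the other summand.\<close>
    also have "k * (1 / q) \<le> 1 / 2"
      using q qpos by (simp add: field_simps)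
    finally have "1 / 2 \<le> q * \<bar>k * \<alpha> - m\<bar>" by linarith
    also have "\<dots> \<le> (2 * (M + 1)\<^sup>2 * k) * \<bar>k * \<alpha> - m\<bar>"
      using qle by (intro mult_right_mono) auto
    finally have "1 \<le> \<bar>k * \<alpha> - m\<bar> * (4 * (M + 1)\<^sup>2 * k)" by (simp add: algebra_simps)
    moreover have "4 * (real M + 1)\<^sup>2 * k > 0" using k by simp
    ultimately show ?thesis
      using k by (simp add: divide_le_eq add.commute)
  qed
  moreover have "1 / (4 * (real M + 1)\<^sup>2) > 0" by simp
  ultimately have "badly_approximable (1 / (4 * (real M + 1)\<^sup>2)) \<alpha>"
    by (simp add: badly_approximable_def add.commute)
  then show thesis by (rule that)
qed

section \<open>Orbits of badly approximable rotations\<close>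

text \<open>The arc is shortened by 1/n at each end to absorb the error of replacing \<alpha> by
  p/q. What remains is longer than 1/q, so it contains a point of the coset; this accounts for the
  constant \<open>2 + 1 / c\<close>.\<close>

lemma badly_approximable_orbit_hits:
  fixes \<alpha> :: real and n :: nat
  assumes bad: "badly_approximable c \<alpha>"
    and n: "n > 0" and d: "d \<ge> (2 + 1 / c) / n"
  obtains j :: nat and m :: int where "j < n" "u \<le> x + j * \<alpha> + m" "x + j * \<alpha> + m < u + d"
proof -
  note c = badly_approximableD(1)[OF bad]
  obtain p q where pq: "coprime p q" "0 < q" "q \<le> int n" "\<bar>of_int q * \<alpha> - of_int p\<bar> < 1 / n"
    using Dirichlet_approx_coprime[OF n] by metis
  have "c / q < 1 / n"
    using badly_approximableD(2)[OF bad pq(2), of p] pq(4) by linarith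
  then have "1 / q < 1 / (c * n)"
    using c n pq(2) by (simp add: field_simps)
  then have len: "2 / n + 1 / q < d"
    using d c n by (simp add: add_divide_distrib)
  \<comment> \<open>\<open>x + t / q\<close> is the first coset point at or beyond the left end of
    the shortened arc.\<close>
  define t where "t = \<lceil>(u + 1 / n - x) * q\<rceil>"
  have t1: "u + 1 / n \<le> x + t / q"
  proof -
    have "(u + 1 / n - x) * q \<le> t" unfolding t_def by linarith
    then have "u + 1 / n - x \<le> t / q" using pq(2) by (simp add: pos_le_divide_eq)
    then show ?thesis by linarith
  qed
  have t2: "x + t / q < u + d - 1 / n"
  proof -
    have "t < (u + 1 / n - x) * q + 1" unfolding t_def by linarith
    then have "t / q < ((u + 1 / n - x) * q + 1) / q"
      using pq(2) by (simp add: divide_strict_right_mono)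
    also have "\<dots> = u + 1 / n - x + 1 / q" using pq(2) by (simp add: add_divide_distrib)
    finally show ?thesis using len by (simp add: field_simps)
  qed
  \<comment> \<open>With \<open>v\<close> inverse to \<open>p\<close> modulo \<open>q\<close>, the
    time \<open>j = v * t mod q\<close> satisfies j p = t modulo q, so the rational rotation reaches
    the chosen point modulo 1.\<close>
  obtain v where "[p * v = 1] (mod q)"
    using cong_solve_coprime_int[OF pq(1)] by blast
  then have "[p * v * t = 1 * t] (mod q)"
    by (rule cong_mult) simp
  then have "[p * (v * t mod q) = t] (mod q)"
    by (simp add: cong_def mod_simps mult.assoc)
  then obtain m where m: "t = p * (v * t mod q) + m * q"
    by (metis cong_iff_lin cong_sym mult.commute)
  define j where "j = nat (v * t mod q)"
  have j: "int j = v * t mod q" "int j < q"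
    using pq(2) by (auto simp: j_def)
  \<comment> \<open>As j < q, the drift accumulated up to time \<open>j\<close> stays within
    Dirichlet's bound 1/n.\<close>
  have err: "\<bar>j * (\<alpha> - p / q)\<bar> \<le> 1 / n"
  proof -
    have "\<bar>j * (\<alpha> - p / q)\<bar> = (j / q) * \<bar>q * \<alpha> - p\<bar>"
    proof -
      have "j * (\<alpha> - p / q) = (j / q) * (q * \<alpha> - p)"
        using pq(2) by (simp add: field_simps)
      then show ?thesis using pq(2) by (simp add: abs_mult)
    qed
    also have "\<dots> \<le> 1 * (1 / n)"
    proof (rule mult_mono)
      have "real j \<le> q" using j(2) by linarith
      then show "j / q \<le> 1" using pq(2) by simp
    qed (use pq in auto)
    finally show ?thesis by simp
  qed
  have "real_of_int t = p * j + m * q"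
    using m j(1) by (metis of_int_add of_int_mult of_int_of_nat_eq)
  then have "t / q = p * j / q + m"
    using pq(2) by (simp add: field_simps)
  moreover define e where "e = j * (\<alpha> - p / q)"
  ultimately have eq: "x + j * \<alpha> + m = x + t / q + e"
    by (simp add: algebra_simps)
  have e: "\<bar>e\<bar> \<le> 1 / n"
    using err by (simp only: e_def)
  show thesis
  proof (rule that[of j m])
    show "j < n" using j(2) pq(3) by linarith
    show "u \<le> x + j * \<alpha> + m" "x + j * \<alpha> + m < u + d"
      unfolding eq using t1 t2 e by linarith+
  qed
qed

lemma separated_below_half:
  fixes r s \<alpha> :: real and n :: nat and m :: int
  assumes bad: "badly_approximable c \<alpha>"
    and n: "n > 0" and d: "s - r - m \<ge> (2 + 1 / c) / n" "s - r - m \<le> 1 / 2"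
  obtains k where "k < n" "frac (r + k * \<alpha>) < 1 / 2" "frac (s + k * \<alpha>) \<ge> 1 / 2"
proof -
  note c = badly_approximableD(1)[OF bad]
  define d where "d = s - r - m"
  obtain k :: nat and l :: int where k: "k < n" "1 / 2 - d \<le> r + k * \<alpha> + l" "r + k * \<alpha> + l < 1 / 2 - d + d"
    using badly_approximable_orbit_hits[OF bad n d(1), of "1 / 2 - d" r] by (auto simp: d_def)
  have "(2 + 1 / c) / n \<ge> 0" using c by simp
  then have "d \<ge> 0" "d \<le> 1 / 2"
    using d unfolding d_def by linarith+
  \<comment> \<open>The bound d \<le> 1/2 keeps the two lifts in [0, 1/2) and [1/2, 1), so they are
    the fractional parts themselves.\<close>
  have "frac (r + k * \<alpha>) = r + k * \<alpha> + l"
    unfolding frac_unique_iff using k \<open>d \<le> 1 / 2\<close> by auto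
  moreover have "frac (s + k * \<alpha>) = r + k * \<alpha> + l + d"
    unfolding frac_unique_iff using k \<open>d \<ge> 0\<close> \<open>d \<le> 1 / 2\<close> by (auto simp: d_def)
  ultimately show thesis
    using k by (intro that[of k]) auto
qed

lemma same_itinerary_imp_close:
  fixes r s \<alpha> :: real and n :: nat
  assumes bad: "badly_approximable c \<alpha>"
    and n: "n > 0"
    and same: "\<And>k. k < n \<Longrightarrow> frac (r + k * \<alpha>) < 1 / 2 \<longleftrightarrow> frac (s + k * \<alpha>) < 1 / 2"
  obtains m :: int where "\<bar>s - r - m\<bar> < (2 + 1 / c) / n"
proof (rule ccontr)
  assume "\<not> thesis"
  then have far: "\<bar>s - r - m\<bar> \<ge> (2 + 1 / c) / n" for m :: int
    using that by (meson not_le)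
  \<comment> \<open>The nearest integer brings the gap within the 1/2 demanded by
    \<open>separated_below_half\<close>.\<close>
  define m where "m = round (s - r)"
  have half: "\<bar>s - r - m\<bar> \<le> 1 / 2"
    using of_int_round_abs_le[of "s - r"] by (simp add: m_def abs_minus_commute)
  show False
  proof (cases "s - r - m \<ge> 0")
    case True
    then obtain k where "k < n" "frac (r + k * \<alpha>) < 1 / 2" "frac (s + k * \<alpha>) \<ge> 1 / 2"
      using separated_below_half[OF bad n, where r = r and s = s and m = m] far[of m] half by auto
    then show False using same by force
  next
    \<comment> \<open>A negative gap is treated by exchanging the two points, which turns
      \<open>m\<close> into \<open>- m\<close>.\<close>
    case False
    then obtain k where "k < n" "frac (s + k * \<alpha>) < 1 / 2" "frac (r + k * \<alpha>) \<ge> 1 / 2"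
      using separated_below_half[OF bad n, where r = s and s = r and m = "- m"] far[of m] half by auto
    then show False using same by force
  qed
qed

section \<open>Cylinders and return times\<close>

text \<open>In a partition each point lies in exactly one atom, \<open>F z\<close> below. A join
  element containing \<open>x\<close> must therefore use the atom of \<open>(T ^^ k) x\<close> at
  each time \<open>k\<close>, which resolves the definite description.\<close>

lemma cylinder_eq:
  assumes cover: "\<Union>Z = UNIV" and disj: "disjoint Z"
  shows "cylinder T Z n x = {y. \<forall>k<n. \<forall>A\<in>Z. (T ^^ k) x \<in> A \<longleftrightarrow> (T ^^ k) y \<in> A}"
    (is "_ = ?C")
proof -
  have same: "A = B" if "A \<in> Z" "B \<in> Z" "z \<in> A" "z \<in> B" for A B z
    using disj that unfolding pairwise_def disjnt_def by blast
  define F where "F z = (SOME A. A \<in> Z \<and> z \<in> A)" for z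
  have "F z \<in> Z \<and> z \<in> F z" for z
  proof -
    have "z \<in> \<Union>Z" by (simp add: cover)
    then have "\<exists>A. A \<in> Z \<and> z \<in> A" by auto
    then show ?thesis unfolding F_def by (rule someI_ex)
  qed
  then have F: "F z \<in> Z" "z \<in> F z" for z by auto
  have atom: "(\<forall>A\<in>Z. u \<in> A \<longleftrightarrow> v \<in> A) \<longleftrightarrow> v \<in> F u" for u v
    using F[of u] same by blast
  have C: "?C = (\<Inter>k\<in>{0..<n}. (T ^^ k) -` F ((T ^^ k) x))"
    by (auto simp: atom)
  have unique: "B = ?C" if "B \<in> join_partitions {0..<n} (\<lambda>k. pullback_partition T k Z)" "x \<in> B" for B
  proof -
    obtain A where A: "\<forall>k\<in>{0..<n}. A k \<in> pullback_partition T k Z" "B = (\<Inter>k\<in>{0..<n}. A k)"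
      using \<open>B \<in> _\<close> by (auto simp: join_partitions_def)
    have "A k = (T ^^ k) -` F ((T ^^ k) x)" if k: "k \<in> {0..<n}" for k
    proof -
      obtain D where D: "D \<in> Z" "A k = (T ^^ k) -` D"
        using A(1)[THEN bspec, OF k] unfolding pullback_partition_def by blast
      have "(T ^^ k) x \<in> D" using \<open>x \<in> B\<close> A(2) D(2) k by auto
      then show ?thesis using same[OF D(1)] F D(2) by blast
    qed
    then show ?thesis using A(2) C by auto
  qed
  have "?C \<in> join_partitions {0..<n} (\<lambda>k. pullback_partition T k Z)"
    unfolding join_partitions_def
  proof (intro CollectI conjI exI[of _ "\<lambda>k. (T ^^ k) -` F ((T ^^ k) x)"])
    show "?C \<noteq> {}" by blast
    show "\<forall>k\<in>{0..<n}. (T ^^ k) -` F ((T ^^ k) x) \<in> pullback_partition T k Z"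
      using F by (auto simp: pullback_partition_def)
  qed (fact C)
  then have "?C \<in> join_partitions {0..<n} (\<lambda>k. pullback_partition T k Z) \<and> x \<in> ?C"
    by simp
  then show ?thesis
    unfolding cylinder_def by (rule the_equality) (rule unique, simp_all only:)
qed

lemma to_circle_eq_iff: "to_circle r = to_circle s \<longleftrightarrow> r - s \<in> \<int>"
  by (rule circle.abs_eq_iff)

lemma circle_exhaust: obtains r where "x = to_circle r"
  using circle.abs_induct[of "\<lambda>x. \<exists>r. x = to_circle r" x] by blast

text \<open>[0, 1) is a fundamental domain, so \<open>frac r\<close> is the only representative that
  can lie in \<open>I\<close>.\<close>

lemma to_circle_mem_iff:
  assumes "I \<subseteq> {0..<1}"
  shows "to_circle r \<in> to_circle ` I \<longleftrightarrow> frac r \<in> I"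
proof
  assume "to_circle r \<in> to_circle ` I"
  then obtain s where s: "s \<in> I" "r - s \<in> \<int>" by (auto simp: to_circle_eq_iff)
  then have "frac r = s" using assms by (auto simp: frac_unique_iff)
  then show "frac r \<in> I" using s by simp
next
  assume "frac r \<in> I"
  moreover have "to_circle r = to_circle (frac r)"
    by (simp add: to_circle_eq_iff frac_def)
  ultimately show "to_circle r \<in> to_circle ` I" by blast
qed

lemma rotation_funpow: "(rotation \<alpha> ^^ k) (to_circle r) = to_circle (r + k * \<alpha>)"
  by (induction k) (auto simp: rotation.abs_eq algebra_simps)

lemma Union_half_circles: "\<Union>half_circles = UNIV"
proof -
  have "x \<in> \<Union>half_circles" for x
    by (cases x rule: circle_exhaust)
       (auto simp: half_circles_def to_circle_mem_iff frac_lt_1 subset_iff not_less)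
  then show ?thesis by blast
qed

lemma disjoint_half_circles: "disjoint half_circles"
proof -
  have "to_circle ` {0..<1/2} \<inter> to_circle ` {1/2..<1} = {}"
  proof -
    have "x \<notin> to_circle ` {0..<1/2} \<inter> to_circle ` {1/2..<1}" for x
      by (cases x rule: circle_exhaust) (simp add: to_circle_mem_iff subset_iff)
    then show ?thesis by blast
  qed
  then show ?thesis
    by (auto simp: half_circles_def pairwise_def disjnt_def)
qed

text \<open>Transfers itineraries to real lifts, in the form taken by
  \<open>same_itinerary_imp_close\<close>.\<close>

lemma cylinder_half_circles_frac:
  assumes "to_circle s \<in> cylinder (rotation \<alpha>) half_circles n (to_circle r)" and "k < n"
  shows "frac (r + k * \<alpha>) < 1 / 2 \<longleftrightarrow> frac (s + k * \<alpha>) < 1 / 2"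
proof -
  have "to_circle ` {0..<1/2} \<in> half_circles" by (simp add: half_circles_def)
  with assms have "to_circle (r + k * \<alpha>) \<in> to_circle ` {0..<1/2} \<longleftrightarrow>
      to_circle (s + k * \<alpha>) \<in> to_circle ` {0..<1/2}"
    by (auto simp: cylinder_eq[OF Union_half_circles disjoint_half_circles] rotation_funpow)
  then show ?thesis
    by (simp add: to_circle_mem_iff subset_iff)
qed

lemma return_time_ge:
  fixes \<alpha> :: real
  assumes bad: "badly_approximable c \<alpha>"
    and n: "n > 0" and k: "k > 0"
    and ret: "(rotation \<alpha> ^^ k) ` cylinder (rotation \<alpha>) half_circles n x \<inter>
      cylinder (rotation \<alpha>) half_circles n x \<noteq> {}"
  shows "c / (2 + 1 / c) * n \<le> k"
proof -
  note c = badly_approximableD(1)[OF bad]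
  obtain r where x: "x = to_circle r" by (rule circle_exhaust)
  obtain y where y: "y \<in> cylinder (rotation \<alpha>) half_circles n x"
      "(rotation \<alpha> ^^ k) y \<in> cylinder (rotation \<alpha>) half_circles n x"
    using ret by blast
  obtain s where s: "y = to_circle s" by (rule circle_exhaust)
  \<comment> \<open>Both \<open>y\<close> and its image follow the itinerary of \<open>x\<close>.
    Their lifts differ by \<open>k * \<alpha>\<close>, whatever \<open>s\<close> is.\<close>
  have "frac (s + j * \<alpha>) < 1 / 2 \<longleftrightarrow> frac (s + k * \<alpha> + j * \<alpha>) < 1 / 2" if "j < n" for j
    using cylinder_half_circles_frac[OF y(1)[unfolded s x] that]
      cylinder_half_circles_frac[OF y(2)[unfolded s x rotation_funpow] that] by simp
  then obtain m :: int where "\<bar>s + k * \<alpha> - s - m\<bar> < (2 + 1 / c) / n"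
    using same_itinerary_imp_close[OF bad n, of s "s + k * \<alpha>"] by blast
  then have "c / k < (2 + 1 / c) / n"
    using badly_approximableD(2)[OF bad, of "int k" m] k by simp
  moreover have "2 + 1 / c > 0" using c by (simp add: add_pos_pos)
  ultimately show ?thesis
    using n k by (simp add: field_simps)
qed

text \<open>Rounding \<open>b\<close> up to a natural number allows the comparison inside
  \<open>enat\<close>, where an empty set of return times has infimum \<infinity>.\<close>

lemma return_time_ge_real:
  assumes "\<And>k. k > 0 \<Longrightarrow> (T ^^ k) ` A \<inter> A \<noteq> {} \<Longrightarrow> b \<le> real k"
  shows "ereal b \<le> ereal_of_enat (return_time T A)"
proof -
  have "enat (nat \<lceil>b\<rceil>) \<le> return_time T A"
    unfolding return_time_def using assms by (intro Inf_greatest) (force simp: nat_le_iff ceiling_le_iff)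
  then have "ereal_of_enat (enat (nat \<lceil>b\<rceil>)) \<le> ereal_of_enat (return_time T A)"
    by (simp only: ereal_of_enat_le_iff)
  moreover have "b \<le> real (nat \<lceil>b\<rceil>)" by linarith
  ultimately show ?thesis
    by (metis ereal_less_eq(3) ereal_of_enat_simps(1) order_trans)
qed

text \<open>The Landau symbol bounds only a tail; for sequences, the finitely many remaining terms
  are covered by enlarging the constant.\<close>

lemma bigo_one_imp_bounded:
  fixes a :: "nat \<Rightarrow> nat"
  assumes "(\<lambda>i. real (a i)) \<in> O(\<lambda>_. 1)"
  obtains M where "\<And>i. a i \<le> M"
proof -
  have "Bfun (\<lambda>i. real (a i)) sequentially"
    using assms by (auto simp: Bfun_def elim!: landau_o.bigE)
  then have "Bseq (\<lambda>i. real (a i))" .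
  then obtain K where "\<And>i. norm (real (a i)) \<le> K"
    by (meson BseqE)
  then have "a i \<le> nat \<lceil>K\<rceil>" for i
    by (metis abs_of_nat le_nat_iff nat_ceiling_le_eq of_nat_0_le_iff real_norm_def real_nat_ceiling_ge of_nat_le_iff order_trans)
  then show thesis by (rule that)
qed

theorem theorem9:
  fixes \<alpha> :: real and a :: "nat \<Rightarrow> nat"
  assumes "0 < \<alpha>" and "\<alpha> < 1" and "\<alpha> \<notin> \<rat>"
    and "has_cfrac_expansion \<alpha> a"
    and "(\<lambda>i. real (a i)) \<in> O(\<lambda>_. 1)"
  shows "\<forall>x :: circle. lower_recurrence_rate x (rotation \<alpha>) half_circles > 0"
proof
  fix x :: circle
  obtain M where "\<And>i. a i \<le> M"
    using bigo_one_imp_bounded[OF assms(5)] by blast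
  then obtain c where bad: "badly_approximable c \<alpha>"
    using bounded_cfrac_imp_badly_approximable[OF assms(4)] by blast
  then have c: "c > 0" by (rule badly_approximableD)
  \<comment> \<open>This is the linear rate from \<open>return_time_ge\<close>; it depends on
    neither \<open>x\<close> nor \<open>n\<close>.\<close>
  define b where "b = c / (2 + 1 / c)"
  let ?\<tau> = "\<lambda>n. ereal_of_enat (return_time (rotation \<alpha>) (cylinder (rotation \<alpha>) half_circles n x))"
  have "ereal b \<le> ?\<tau> n / ereal (real n)" if n: "n > 0" for n
  proof -
    have "ereal (b * n) \<le> ?\<tau> n"
      unfolding b_def by (rule return_time_ge_real) (rule return_time_ge[OF bad n])
    then show ?thesis
      using n by (subst ereal_le_divide_pos) (auto simp: mult.commute)
  qed
  \<comment> \<open>The quotient is bounded only for n > 0, which holds eventually and so suffices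
    for the lower limit.\<close>
  then have "ereal b \<le> lower_recurrence_rate x (rotation \<alpha>) half_circles"
    unfolding lower_recurrence_rate_def
    by (intro Liminf_bounded eventually_mono[OF eventually_gt_at_top[of 0]])
  moreover have "ereal b > 0"
    using c by (simp add: b_def add_pos_pos)
  ultimately show "lower_recurrence_rate x (rotation \<alpha>) half_circles > 0"
    by (rule less_le_trans[rotated])
qed

end
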